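(* Let $\langle AR, ATT\rangle$ be an argumentation framework with $AR=\{A_1,A_2,\ldots,A_n\}$ (the $A_i$ distinct), and regard the arguments $A_1,\dots,A_n$ as variables. Let $$\mathbf{E}=\Big\{A_i\equiv\bigwedge_{(A,A_i)\in ATT}\neg A \;\Big|\; 1\le i\le n\Big\}[A_1][A_2]\cdots[A_n].$$ Then the allocator $E$ defined by $E(A)=\mathrm{RE}(\mathbf{E}(A))$ for $A\in AR$ is a general allocator of $\langle AR,ATT\rangle$.
   Context: **Expressions.** Three-valued logical expressions are $p ::= T\mid F\mid U\mid x\mid \neg p\mid p\land p\mid p\lor p$, $x$ a variable; $\land$ is often written as juxtaposition. A valuation is a map $v$ from variables to $\{T,F,U\}$; $[\![p]\!]_v$ is the evaluation in Kleene's strong three-valued logic: with $F<U<T$, $\land$ is min, $\lor$ is max, $\neg$ swaps $T$ and $F$ and fixes $U$, constants evaluate to themselves, $[\![x]\!]_v=v(x)$. $p\equiv q$ (equivalence) means $[\![p]\!]_v=[\![q]\!]_v$ for all $v$. $\mathrm{Var}(p)$ is the set of variables occurring (syntactically) in $p$. $p[p'/x]$ is the substitution of $p'$ for $x$ in $p$. An empty conjunction is $T$. **Argumentation frameworks and allocators.** An argumentation framework $\langle AR,ATT\rangle$ is a set $AR$ of arguments with a binary relation $ATT\subseteq AR\times AR$. An allocator is a map from $AR$ to expressions. An allocator $E$ is complete iff $E(A)\equiv\bigwedge_{(A',A)\in ATT}\neg E(A')$ for all $A\in AR$. A constant allocator is a complete allocator all of whose values are logical constants in $\{T,F,U\}$.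 For a valuation $v$, $E_v(A)=[\![E(A)]\!]_v$. A complete allocator $E$ is general iff for every constant allocator $E'$ there is a valuation $v$ with $E'=E_v$. **Variable equation sets.** A variable equation is a formal equation $X\equiv G$ with $X$ a variable and $G$ an expression; $\mathrm{LV}(X\equiv G)=X$, $\mathrm{RE}(X\equiv G)=G$. A variable equation set $\mathbf{E}$ is a set of variable equations with pairwise distinct left-hand variables; $\mathbf{E}(X)$ is the equation in $\mathbf{E}$ with left-hand variable $X$. **The transformation $\mathcal{R}_x$.** For quadruples of expressions $Q_i=(P_i,N_i,C_i,M_i)$, $i=1,2$, put $Q_1\sqcup Q_2=(P_1\lor P_2,\,N_1\lor N_2,\,C_1\lor C_2,\,M_1\lor M_2)$ and $Q_1\sqcap Q_2=(P_1P_2\lor P_1M_2\lor P_2M_1,\; N_1N_2\lor N_1M_2\lor N_2M_1,\; (P_1\lor N_1\lor M_1)C_2\lor(P_2\lor N_2\lor M_2)C_1\lor C_1C_2\lor P_1N_2\lor N_1P_2,\; M_1M_2)$. For a variable $x$, define $\mathcal{R}_x,\overline{\mathcal{R}}_x$ by mutual recursion ($c$ a logical constant, $y\ne x$ a variable): $\mathcal{R}_x(c)=(F,F,F,c)$, $\mathcal{R}_x(x)=(T,F,F,F)$, $\mathcal{R}_x(y)=(F,F,F,y)$, $\mathcal{R}_x(\neg p)=\overline{\mathcal{R}}_x(p)$, $\mathcal{R}_x(p_1\lor p_2)=\mathcal{R}_x(p_1)\sqcup\mathcal{R}_x(p_2)$, $\mathcal{R}_x(p_1p_2)=\mathcal{R}_x(p_1)\sqcap\mathcal{R}_x(p_2)$;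 $\overline{\mathcal{R}}_x(c)=(F,F,F,\neg c)$, $\overline{\mathcal{R}}_x(x)=(F,T,F,F)$, $\overline{\mathcal{R}}_x(y)=(F,F,F,\neg y)$, $\overline{\mathcal{R}}_x(\neg p)=\mathcal{R}_x(p)$, $\overline{\mathcal{R}}_x(p_1p_2)=\overline{\mathcal{R}}_x(p_1)\sqcup\overline{\mathcal{R}}_x(p_2)$, $\overline{\mathcal{R}}_x(p_1\lor p_2)=\overline{\mathcal{R}}_x(p_1)\sqcap\overline{\mathcal{R}}_x(p_2)$. **Substitution step.** For a variable equation $X\equiv G$ with $(P,N,C,M)=\mathcal{R}_X(G)$, $\mathrm{ref}(X\equiv G)$ is the equation $X\equiv P\,x\lor U(N\lor C\,x)\lor M$, with $x$ a fresh variable. For a variable equation set $\mathbf{E}$ with an equation for $X$, $\mathbf{E}[X]=\{X\equiv H\}\cup\{\mathrm{LV}(E')\equiv\mathrm{RE}(E')[H/X]\mid E'\in\mathbf{E}\setminus\{\mathbf{E}(X)\}\}$ where $X\equiv H$ is $\mathrm{ref}(\mathbf{E}(X))$ and its fresh variable does not occur in any equation of $\mathbf{E}$ (on either side). *)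

theory Defs
  imports Main
begin

datatype tv = F | U | T

instantiation tv :: linorder
begin

primrec tv_rank :: "tv \<Rightarrow> nat" where
  "tv_rank F = 0"
| "tv_rank U = 1"
| "tv_rank T = 2"

definition less_eq_tv :: "tv \<Rightarrow> tv \<Rightarrow> bool" where
  "a \<le> b \<longleftrightarrow> tv_rank a \<le> tv_rank b"

definition less_tv :: "tv \<Rightarrow> tv \<Rightarrow> bool" where
  "a < b \<longleftrightarrow> tv_rank a < tv_rank b"

instance
proof
  fix a b :: tv
  show "a \<le> b \<Longrightarrow> b \<le> a \<Longrightarrow> a = b"
    by (cases a; cases b) (simp_all add: less_eq_tv_def)
qed (auto simp: less_eq_tv_def less_tv_def)

end

primrec tv_not :: "tv \<Rightarrow> tv" where
  "tv_not F = T"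
| "tv_not U = U"
| "tv_not T = F"

datatype (vars: 'v) expr =
    Const tv
  | Var 'v
  | Neg "'v expr"
  | Conj "'v expr" "'v expr" (infixr "\<sqdot>" 75)
  | Disj "'v expr" "'v expr" (infixl "\<squnion>" 70)

primrec eval :: "('v \<Rightarrow> tv) \<Rightarrow> 'v expr \<Rightarrow> tv" where
  "eval v (Const c) = c"
| "eval v (Var x) = v x"
| "eval v (Neg p) = tv_not (eval v p)"
| "eval v (Conj p q) = min (eval v p) (eval v q)"
| "eval v (Disj p q) = max (eval v p) (eval v q)"

definition equivalent :: "'v expr \<Rightarrow> 'v expr \<Rightarrow> bool" where
  "equivalent p q \<longleftrightarrow> (\<forall>v. eval v p = eval v q)"

text \<open>\<open>subst p q x\<close> is $p[q/x]$.\<close>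

primrec subst :: "'v expr \<Rightarrow> 'v expr \<Rightarrow> 'v \<Rightarrow> 'v expr" where
  "subst (Const c) q x = Const c"
| "subst (Var y) q x = (if y = x then q else Var y)"
| "subst (Neg p) q x = Neg (subst p q x)"
| "subst (Conj p1 p2) q x = Conj (subst p1 q x) (subst p2 q x)"
| "subst (Disj p1 p2) q x = Disj (subst p1 q x) (subst p2 q x)"

text \<open>
  \<open>is_conj f S c\<close>: the expression \<open>c\<close> is a conjunction of the \<open>f s\<close>, \<open>s \<in> S\<close>, each index used
  once, in an arbitrary order and bracketing. The binary connective is syntactic, so a finite
  set does not determine a unique expression; all these expressions are equivalent.
\<close>

inductive is_conj :: "('a \<Rightarrow> 'v expr) \<Rightarrow> 'a set \<Rightarrow> 'v expr \<Rightarrow> bool" for f where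
  empty: "is_conj f {} (Const T)"
| single: "is_conj f {s} (f s)"
| union: "\<lbrakk>is_conj f S1 c1; is_conj f S2 c2; S1 \<noteq> {}; S2 \<noteq> {}; S1 \<inter> S2 = {}\<rbrakk>
    \<Longrightarrow> is_conj f (S1 \<union> S2) (Conj c1 c2)"

definition argumentation_framework :: "'a set \<Rightarrow> ('a \<times> 'a) set \<Rightarrow> bool" where
  "argumentation_framework AR ATT \<longleftrightarrow> ATT \<subseteq> AR \<times> AR"

definition attackers :: "('a \<times> 'a) set \<Rightarrow> 'a \<Rightarrow> 'a set" where
  "attackers ATT A = {A'. (A', A) \<in> ATT}"

text \<open>Allocators are total functions of which only the values on \<open>AR\<close> matter.\<close>

definition complete_allocator ::
    "'a set \<Rightarrow> ('a \<times> 'a) set \<Rightarrow> ('a \<Rightarrow> 'v expr) \<Rightarrow> bool" where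
  "complete_allocator AR ATT E \<longleftrightarrow>
     (\<forall>A\<in>AR. \<exists>c. is_conj (\<lambda>A'. Neg (E A')) (attackers ATT A) c \<and> equivalent (E A) c)"

definition constant_allocator ::
    "'a set \<Rightarrow> ('a \<times> 'a) set \<Rightarrow> ('a \<Rightarrow> 'v expr) \<Rightarrow> bool" where
  "constant_allocator AR ATT E \<longleftrightarrow>
     complete_allocator AR ATT E \<and> (\<forall>A\<in>AR. \<exists>c. E A = Const c)"

definition general_allocator ::
    "'a set \<Rightarrow> ('a \<times> 'a) set \<Rightarrow> ('a \<Rightarrow> 'v expr) \<Rightarrow> bool" where
  "general_allocator AR ATT E \<longleftrightarrow>
     complete_allocator AR ATT E \<and>
     (\<forall>E' :: 'a \<Rightarrow> 'v expr. constant_allocator AR ATT E' \<longrightarrow>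
        (\<exists>v. \<forall>A\<in>AR. E' A = Const (eval v (E A))))"

type_synonym 'v var_eqn = "'v \<times> 'v expr"

abbreviation LV :: "'v var_eqn \<Rightarrow> 'v" where "LV \<equiv> fst"

abbreviation RE :: "'v var_eqn \<Rightarrow> 'v expr" where "RE \<equiv> snd"

definition var_eqn_set :: "'v var_eqn set \<Rightarrow> bool" where
  "var_eqn_set E \<longleftrightarrow> inj_on LV E"

definition eqn_of :: "'v var_eqn set \<Rightarrow> 'v \<Rightarrow> 'v var_eqn" where
  "eqn_of E X = (THE e. e \<in> E \<and> LV e = X)"

definition eqn_vars :: "'v var_eqn set \<Rightarrow> 'v set" where
  "eqn_vars E = (\<Union>e\<in>E. insert (LV e) (vars (RE e)))"

type_synonym 'v quad = "'v expr \<times> 'v expr \<times> 'v expr \<times> 'v expr"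

fun quad_join :: "'v quad \<Rightarrow> 'v quad \<Rightarrow> 'v quad" where
  "quad_join (P1, N1, C1, M1) (P2, N2, C2, M2) =
     (P1 \<squnion> P2, N1 \<squnion> N2, C1 \<squnion> C2, M1 \<squnion> M2)"

fun quad_meet :: "'v quad \<Rightarrow> 'v quad \<Rightarrow> 'v quad" where
  "quad_meet (P1, N1, C1, M1) (P2, N2, C2, M2) =
     (P1 \<sqdot> P2 \<squnion> P1 \<sqdot> M2 \<squnion> P2 \<sqdot> M1,
      N1 \<sqdot> N2 \<squnion> N1 \<sqdot> M2 \<squnion> N2 \<sqdot> M1,
      (P1 \<squnion> N1 \<squnion> M1) \<sqdot> C2 \<squnion> (P2 \<squnion> N2 \<squnion> M2) \<sqdot> C1 \<squnion> C1 \<sqdot> C2 \<squnion> P1 \<sqdot> N2 \<squnion> N1 \<sqdot> P2,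
      M1 \<sqdot> M2)"

abbreviation (input) FF :: "'v expr" where "FF \<equiv> Const F"

text \<open>\<open>quad_pos x\<close> is $\mathcal{R}_x$ and \<open>quad_neg x\<close> is $\overline{\mathcal{R}}_x$.\<close>

fun quad_pos :: "'v \<Rightarrow> 'v expr \<Rightarrow> 'v quad"
  and quad_neg :: "'v \<Rightarrow> 'v expr \<Rightarrow> 'v quad" where
  "quad_pos x (Const c) = (FF, FF, FF, Const c)"
| "quad_pos x (Var y) = (if y = x then (Const T, FF, FF, FF) else (FF, FF, FF, Var y))"
| "quad_pos x (Neg p) = quad_neg x p"
| "quad_pos x (Disj p1 p2) = quad_join (quad_pos x p1) (quad_pos x p2)"
| "quad_pos x (Conj p1 p2) = quad_meet (quad_pos x p1) (quad_pos x p2)"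
| "quad_neg x (Const c) = (FF, FF, FF, Neg (Const c))"
| "quad_neg x (Var y) = (if y = x then (FF, Const T, FF, FF) else (FF, FF, FF, Neg (Var y)))"
| "quad_neg x (Neg p) = quad_pos x p"
| "quad_neg x (Conj p1 p2) = quad_join (quad_neg x p1) (quad_neg x p2)"
| "quad_neg x (Disj p1 p2) = quad_meet (quad_neg x p1) (quad_neg x p2)"

text \<open>The choice of fresh variable \<open>x\<close> is a parameter here.\<close>

definition ref :: "'v \<Rightarrow> 'v var_eqn \<Rightarrow> 'v var_eqn" where
  "ref x e = (case quad_pos (LV e) (RE e) of
     (P, N, C, M) \<Rightarrow> (LV e, P \<sqdot> Var x \<squnion> Const U \<sqdot> (N \<squnion> C \<sqdot> Var x) \<squnion> M))"

text \<open>
  \<open>subst_step E X E'\<close>: \<open>E'\<close> is $E[X]$ for some choice of a fresh variable.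
  \<open>subst_steps E [X\<^sub>1, \<dots>, X\<^sub>n] E'\<close>: \<open>E'\<close> is $E[X_1]\cdots[X_n]$ for some such choices.
\<close>

definition subst_step :: "'v var_eqn set \<Rightarrow> 'v \<Rightarrow> 'v var_eqn set \<Rightarrow> bool" where
  "subst_step E X E' \<longleftrightarrow>
     var_eqn_set E \<and> X \<in> LV ` E \<and>
     (\<exists>x. x \<notin> eqn_vars E \<and>
        (let r = ref x (eqn_of E X) in
         E' = {r} \<union> {(LV e, subst (RE e) (RE r) X) | e. e \<in> E - {eqn_of E X}}))"

primrec subst_steps :: "'v var_eqn set \<Rightarrow> 'v list \<Rightarrow> 'v var_eqn set \<Rightarrow> bool" where
  "subst_steps E [] E' \<longleftrightarrow> E' = E"
| "subst_steps E (X # Xs) E' \<longleftrightarrow> (\<exists>E1. subst_step E X E1 \<and> subst_steps E1 Xs E')"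

text \<open>Over infinitely many variables, conjunctions and substitution steps always exist.\<close>

lemma is_conj_exists:
  assumes "finite S"
  shows "\<exists>c. is_conj f S c"
  using assms
proof (induction S rule: finite_induct)
  case empty
  show ?case by (blast intro: is_conj.empty)
next
  case (insert s S)
  then obtain c where c: "is_conj f S c" by blast
  show ?case
  proof (cases "S = {}")
    case True
    then show ?thesis by (auto intro: is_conj.single)
  next
    case False
    have "is_conj f ({s} \<union> S) (Conj (f s) c)"
      using c False insert.hyps by (intro is_conj.union is_conj.single) auto
    then show ?thesis by auto
  qed
qed

lemma eqn_of_eq: "var_eqn_set E \<Longrightarrow> e \<in> E \<Longrightarrow> eqn_of E (LV e) = e"
  unfolding eqn_of_def var_eqn_set_def
  by (rule the_equality) (auto dest: inj_onD)

lemma LV_ref: "LV (ref x e) = LV e"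
  by (simp add: ref_def split: prod.split)

lemma finite_vars: "finite (vars p)"
  by (induction p) auto

lemma subst_step_exists:
  fixes E :: "'v var_eqn set"
  assumes inf: "infinite (UNIV :: 'v set)" and fin: "finite E"
    and E: "var_eqn_set E" and X: "X \<in> LV ` E"
  shows "\<exists>E'. subst_step E X E' \<and> finite E' \<and> var_eqn_set E' \<and> LV ` E' = LV ` E"
proof -
  have "finite (eqn_vars E)"
    using fin by (simp add: eqn_vars_def finite_vars)
  then obtain x where x: "x \<notin> eqn_vars E"
    using ex_new_if_finite[OF inf] by blast
  obtain e0 where e0: "e0 \<in> E" "LV e0 = X" using X by auto
  have eq: "eqn_of E X = e0" using eqn_of_eq[OF E e0(1)] e0(2) by simp
  define E' where "E' = {ref x e0} \<union>
    (\<lambda>e. (LV e, subst (RE e) (RE (ref x e0)) X)) ` (E - {e0})"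
  have "subst_step E X E'"
    unfolding subst_step_def Let_def eq E'_def Setcompr_eq_image using E X x by blast
  moreover have "finite E'" using fin by (simp add: E'_def)
  moreover have "LV ` E' = LV ` E"
    using e0 by (force simp: E'_def LV_ref image_iff)
  moreover have "inj_on LV E'"
    using E e0 unfolding E'_def var_eqn_set_def inj_on_def
    by (auto simp: LV_ref)
  ultimately show ?thesis by (auto simp: var_eqn_set_def)
qed

lemma subst_steps_exists:
  fixes E :: "'v var_eqn set"
  assumes "infinite (UNIV :: 'v set)" "finite E" "var_eqn_set E" "set Xs \<subseteq> LV ` E"
  shows "\<exists>E'. subst_steps E Xs E'"
  using assms(2-)
proof (induction Xs arbitrary: E)
  case Nil
  show ?case by simp
next
  case (Cons X Xs)
  then obtain E1 where "subst_step E X E1" "finite E1" "var_eqn_set E1" "LV ` E1 = LV ` E"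
    using subst_step_exists[OF assms(1)] by (metis list.set_intros(1) subsetD)
  with Cons show ?case by (metis set_subset_Cons subset_trans subst_steps.simps(2))
qed

end

theory Submission
  imports Defs
begin

text \<open>
  Distributivity gives $p \equiv Px \lor N\neg x \lor Cx\neg x \lor M$ for
  $(P,N,C,M) = \mathcal{R}_x(p)$. As $P,N,C,M$ are free of $x$, the equation $x \equiv p$ can be
  solved for $x$: each value of $Py \lor U(N \lor Cy) \lor M$ is a solution, and each solution $x$ is
  this value at $y = x$. Hence, up to the values of fresh variables, a substitution step neither adds
  nor loses solutions of a variable equation set. After eliminating every argument, the right-hand
  sides contain no arguments, so any valuation of the remaining variables extends to a solution of
  the original set, and every solution arises in this way.
\<close>

section \<open>Kleene order, evaluation and substitution\<close>

text \<open>Comparing lower bounds turns identities between \<open>min\<close> and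
  \<open>max\<close> into propositional ones, since the order is linear.\<close>

lemma tv_eqI: "(\<And>c. c \<le> a \<longleftrightarrow> c \<le> b) \<Longrightarrow> a = (b :: tv)"
  by (meson order_antisym order_refl)

lemma le_T [simp]: "a \<le> T"
  by (cases a) (simp_all add: less_eq_tv_def)

lemma F_le [simp]: "F \<le> a"
  by (cases a) (simp_all add: less_eq_tv_def)

lemma max_min_tv [simp]:
  "max T a = T" "max a T = T" "max F a = a" "max a F = a"
  "min T a = a" "min a T = a" "min F a = F" "min a F = F"
  by (simp_all add: max_absorb1 max_absorb2 min_absorb1 min_absorb2)

lemma tv_not_not [simp]: "tv_not (tv_not a) = a"
  by (cases a) simp_all

lemma tv_not_min: "tv_not (min a b) = max (tv_not a) (tv_not b)"
  by (cases a; cases b) simp_all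

lemma tv_not_max: "tv_not (max a b) = min (tv_not a) (tv_not b)"
  by (cases a; cases b) simp_all

lemma eval_cong: "(\<And>x. x \<in> vars p \<Longrightarrow> v x = w x) \<Longrightarrow> eval v p = eval w p"
  by (induction p) simp_all

lemma eval_subst: "eval v (subst p q x) = eval (v(x := eval v q)) p"
  by (induction p) simp_all

lemma vars_subst: "vars (subst p q x) \<subseteq> (vars p - {x}) \<union> vars q"
  by (induction p) auto

lemma le_eval_is_conj: "is_conj f S c \<Longrightarrow> a \<le> eval v c \<longleftrightarrow> (\<forall>s\<in>S. a \<le> eval v (f s))"
  by (induction rule: is_conj.induct) auto

text \<open>Both sides are greatest lower bounds of the same family of values, so the order and
  bracketing that \<open>is_conj\<close> leaves open do not matter.\<close>

lemma eval_is_conj_cong: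
  assumes "is_conj f S c" "is_conj g S d" "\<And>s. s \<in> S \<Longrightarrow> eval v (f s) = eval w (g s)"
  shows "eval v c = eval w d"
  using assms by (intro tv_eqI) (simp add: le_eval_is_conj)


subsection \<open>The quadruple transformation\<close>

text \<open>The form P x \<or> N \<not>x \<or> C x \<not>x \<or> M as a function of the value
  \<open>a\<close> of x, with the coefficients reduced to truth values.\<close>

definition quad_form :: "tv \<Rightarrow> tv \<Rightarrow> tv \<Rightarrow> tv \<Rightarrow> tv \<Rightarrow> tv" where
  "quad_form p n c m a =
     max (max (max (min p a) (min n (tv_not a))) (min c (min a (tv_not a)))) m"

fun eval_quad :: "('v \<Rightarrow> tv) \<Rightarrow> tv \<Rightarrow> 'v quad \<Rightarrow> tv" where
  "eval_quad v a (P, N, C, M) = quad_form (eval v P) (eval v N) (eval v C) (eval v M) a"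

fun quad_vars :: "'v quad \<Rightarrow> 'v set" where
  "quad_vars (P, N, C, M) = vars P \<union> vars N \<union> vars C \<union> vars M"

lemma quad_form_join:
  "quad_form (max p p') (max n n') (max c c') (max m m') a
     = max (quad_form p n c m a) (quad_form p' n' c' m' a)"
  unfolding quad_form_def
  by (rule tv_eqI, simp only: le_max_iff_disj min.bounded_iff, argo)

text \<open>Multiply out and group the products by their factor x, \<not>x, x \<not>x or none. Only
  distributive lattice laws enter: \<open>a\<close> and \<open>tv_not a\<close> act as independent
  atoms, as x \<not>x may be U.\<close>

lemma quad_form_meet:
  "quad_form
     (max (max (min p p') (min p m')) (min p' m))
     (max (max (min n n') (min n m')) (min n' m))
     (max (max (max (max (min (max (max p n) m) c') (min (max (max p' n') m') c)) (min c c'))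
       (min p n')) (min n p'))
     (min m m') a
     = min (quad_form p n c m a) (quad_form p' n' c' m' a)"
  unfolding quad_form_def
  by (rule tv_eqI, simp only: le_max_iff_disj min.bounded_iff, argo)

lemma eval_quad_join: "eval_quad v a (quad_join Q1 Q2) = max (eval_quad v a Q1) (eval_quad v a Q2)"
  by (cases Q1; cases Q2) (simp add: quad_form_join)

lemma eval_quad_meet: "eval_quad v a (quad_meet Q1 Q2) = min (eval_quad v a Q1) (eval_quad v a Q2)"
  by (cases Q1; cases Q2) (simp only: quad_meet.simps eval_quad.simps eval.simps quad_form_meet)

lemma quad_form_const: "quad_form F F F m a = m"
  by (simp add: quad_form_def)

lemma quad_form_pos: "quad_form T F F F a = a"
  by (simp add: quad_form_def)

lemma quad_form_neg: "quad_form F T F F a = tv_not a"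
  by (simp add: quad_form_def)

text \<open>Simultaneous induction on both transformations; De Morgan's laws match the exchange of
  join and meet under negation.\<close>

lemma eval_quad_pos_neg:
  "eval_quad v (v x) (quad_pos x p) = eval v p"
  "eval_quad v (v x) (quad_neg x p) = tv_not (eval v p)"
  by (induction x p and x p rule: quad_pos_quad_neg.induct)
    (simp_all add: eval_quad_join eval_quad_meet quad_form_const quad_form_pos quad_form_neg
      tv_not_min tv_not_max)

lemma quad_vars_join: "quad_vars (quad_join Q1 Q2) = quad_vars Q1 \<union> quad_vars Q2"
  by (cases Q1; cases Q2) auto

lemma quad_vars_meet: "quad_vars (quad_meet Q1 Q2) = quad_vars Q1 \<union> quad_vars Q2"
  by (cases Q1; cases Q2) auto

text \<open>An occurrence of x contributes only constants. This is what lets \<open>ref\<close>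
  eliminate its left-hand variable.\<close>

lemma quad_vars_pos_neg:
  "quad_vars (quad_pos x p) \<subseteq> vars p - {x}"
  "quad_vars (quad_neg x p) \<subseteq> vars p - {x}"
  by (induction x p and x p rule: quad_pos_quad_neg.induct)
    (auto simp: quad_vars_join quad_vars_meet)

text \<open>Every parameter y yields a solution h. If h is T, then p or m is T; if h is F, then n
  and m are F; if h is U, then m is not T and one of p, n, c, m is at least U. In each case the form
  at h has value h.\<close>

lemma quad_form_solution:
  "quad_form p n c m (max (max (min p y) (min U (max n (min c y)))) m)
     = max (max (min p y) (min U (max n (min c y)))) m"
  by (cases p; cases n; cases c; cases m; cases y)
    (simp_all add: quad_form_def)

text \<open>At U the two formulas coincide; at T the hypothesis forces p or m to be T, at F it
  forces n and m to be F. So each solution is recovered with itself as parameter.\<close>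

lemma quad_form_fixpoint:
  "quad_form p n c m a = a \<Longrightarrow> max (max (min p a) (min U (max n (min c a)))) m = a"
  by (cases p; cases n; cases c; cases m; cases a)
    (simp_all add: quad_form_def)


subsection \<open>Solutions of variable equation sets\<close>

definition solves :: "('v \<Rightarrow> tv) \<Rightarrow> 'v var_eqn set \<Rightarrow> bool" where
  "solves v E \<longleftrightarrow> (\<forall>e\<in>E. v (LV e) = eval v (RE e))"

definition rhs_vars :: "'v var_eqn set \<Rightarrow> 'v set" where
  "rhs_vars E = (\<Union>e\<in>E. vars (RE e))"

lemma solvesD: "solves v E \<Longrightarrow> e \<in> E \<Longrightarrow> v (LV e) = eval v (RE e)"
  by (simp add: solves_def)

lemma eqn_vars_eq: "eqn_vars E = LV ` E \<union> rhs_vars E"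
  by (auto simp: eqn_vars_def rhs_vars_def)

lemma vars_RE_ref: "vars (RE (ref x e)) \<subseteq> insert x (vars (RE e) - {LV e})"
  using quad_vars_pos_neg(1)[of "LV e" "RE e"]
  by (cases "quad_pos (LV e) (RE e)") (auto simp: ref_def)

lemma eval_ref:
  obtains p n c m where "\<And>v. eval v (RE (ref x e)) =
    max (max (min (p v) (v x)) (min U (max (n v) (min (c v) (v x))))) (m v)"
    "\<And>v. eval v (RE e) = quad_form (p v) (n v) (c v) (m v) (v (LV e))"
proof (cases "quad_pos (LV e) (RE e)")
  case (fields P N C M)
  show thesis
  proof (rule that)
    show "eval v (RE (ref x e)) = max (max (min (eval v P) (v x))
        (min U (max (eval v N) (min (eval v C) (v x))))) (eval v M)" for v
      by (simp only: ref_def fields prod.case snd_conv eval.simps)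
    show "eval v (RE e)
        = quad_form (eval v P) (eval v N) (eval v C) (eval v M) (v (LV e))" for v
      using eval_quad_pos_neg(1)[of v "LV e" "RE e"] by (simp only: fields eval_quad.simps)
  qed
qed

lemma eval_ref_solution:
  assumes "v (LV e) = eval v (RE (ref x e))"
  shows "v (LV e) = eval v (RE e)"
  by (rule eval_ref[of x e]) (metis assms quad_form_solution)

lemma eval_ref_fixpoint:
  assumes "v (LV e) = eval v (RE e)" "v x = v (LV e)"
  shows "eval v (RE (ref x e)) = v (LV e)"
  by (rule eval_ref[of x e]) (metis assms quad_form_fixpoint)

section \<open>A single substitution step\<close>

lemma subst_stepE:
  assumes "subst_step E X E'"
  obtains e0 x where "e0 \<in> E" "LV e0 = X" "x \<notin> eqn_vars E"
    "E' = insert (ref x e0) ((\<lambda>e. (LV e, subst (RE e) (RE (ref x e0)) X)) ` (E - {e0}))"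
proof -
  from assms obtain e0 where e0: "e0 \<in> E" "LV e0 = X" and "var_eqn_set E"
    by (auto simp: subst_step_def)
  then have eq: "eqn_of E X = e0" using eqn_of_eq by blast
  from assms obtain x where "x \<notin> eqn_vars E"
    "E' = insert (ref x e0) ((\<lambda>e. (LV e, subst (RE e) (RE (ref x e0)) X)) ` (E - {e0}))"
    unfolding subst_step_def Let_def eq Setcompr_eq_image by auto
  with e0 that show thesis by blast
qed

lemma subst_step_LV:
  assumes "subst_step E X E'"
  shows "LV ` E' = LV ` E"
  using assms
proof (rule subst_stepE)
  fix e0 x
  assume e0: "e0 \<in> E"
    and E': "E' = insert (ref x e0) ((\<lambda>e. (LV e, subst (RE e) (RE (ref x e0)) X)) ` (E - {e0}))"
  have "LV ` E' = insert (LV e0) (LV ` (E - {e0}))"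
    by (simp add: E' image_image LV_ref)
  also have "\<dots> = LV ` E" using e0 by blast
  finally show ?thesis .
qed

lemma subst_step_var_eqn_set:
  assumes "subst_step E X E'"
  shows "var_eqn_set E'"
  using assms
proof (rule subst_stepE)
  fix e0 x
  assume e0: "e0 \<in> E"
    and E': "E' = insert (ref x e0) ((\<lambda>e. (LV e, subst (RE e) (RE (ref x e0)) X)) ` (E - {e0}))"
  have inj: "inj_on LV E" using assms by (simp add: subst_step_def var_eqn_set_def)
  let ?f = "\<lambda>e. (LV e, subst (RE e) (RE (ref x e0)) X)"
  have "inj_on LV (?f ` (E - {e0}))"
    using inj by (intro inj_on_imageI) (simp add: o_def inj_on_diff)
  moreover have "LV (ref x e0) \<notin> LV ` ?f ` (E - {e0})"
    using inj e0 by (auto simp: LV_ref image_image dest: inj_onD)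
  ultimately show ?thesis
    unfolding var_eqn_set_def E' by (auto simp only: inj_on_insert)
qed

text \<open>The new right-hand side for X is free of X, and substituting it removes X elsewhere. The
  only new variable is fresh, so the intersection with the left-hand variables discards it.\<close>

lemma subst_step_rhs_vars:
  assumes "subst_step E X E'"
  shows "rhs_vars E' \<inter> LV ` E \<subseteq> rhs_vars E - {X}"
  using assms
proof (rule subst_stepE)
  fix e0 x
  assume e0: "e0 \<in> E" "LV e0 = X" and x: "x \<notin> eqn_vars E"
    and E': "E' = insert (ref x e0) ((\<lambda>e. (LV e, subst (RE e) (RE (ref x e0)) X)) ` (E - {e0}))"
  have H: "vars (RE (ref x e0)) \<subseteq> insert x (rhs_vars E - {X})"
    using vars_RE_ref[of x e0] e0 by (auto simp: rhs_vars_def)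
  have sub: "vars (subst (RE e) (RE (ref x e0)) X) \<subseteq> insert x (rhs_vars E - {X})" if "e \<in> E" for e
    using vars_subst[of "RE e" "RE (ref x e0)" X] H that by (auto simp: rhs_vars_def)
  have "vars (RE e) \<subseteq> insert x (rhs_vars E - {X})" if "e \<in> E'" for e
  proof (cases "e = ref x e0")
    case True
    then show ?thesis using H by simp
  next
    case False
    with that obtain e1 where "e1 \<in> E" "e = (LV e1, subst (RE e1) (RE (ref x e0)) X)"
      unfolding E' by blast
    then show ?thesis using sub by simp
  qed
  then have "rhs_vars E' \<subseteq> insert x (rhs_vars E - {X})"
    unfolding rhs_vars_def[of E'] by blast
  then show ?thesis using x by (auto simp: eqn_vars_eq)
qed

text \<open>Under \<open>v\<close>, X and its replacement have equal value, so undoing the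
  substitution changes no value. The old equation for X follows from
  \<open>eval_ref_solution\<close>.\<close>

lemma solves_subst_stepD:
  assumes "subst_step E X E'" "solves v E'"
  shows "solves v E"
  using assms(1)
proof (rule subst_stepE)
  fix e0 x
  assume e0: "e0 \<in> E" "LV e0 = X"
    and E': "E' = insert (ref x e0) ((\<lambda>e. (LV e, subst (RE e) (RE (ref x e0)) X)) ` (E - {e0}))"
  have vX: "v X = eval v (RE (ref x e0))"
    using solvesD[OF assms(2), of "ref x e0"] e0 by (simp only: E' insertI1 LV_ref)
  show ?thesis
    unfolding solves_def
  proof
    fix e assume "e \<in> E"
    show "v (LV e) = eval v (RE e)"
    proof (cases "e = e0")
      case True
      have "v (LV e0) = eval v (RE (ref x e0))" by (simp only: vX e0(2))
      from eval_ref_solution[OF this] show ?thesis by (simp only: True)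
    next
      case False
      then have "(LV e, subst (RE e) (RE (ref x e0)) X) \<in> E'"
        using \<open>e \<in> E\<close> unfolding E' by blast
      from solvesD[OF assms(2) this] show ?thesis
        by (simp only: fst_conv snd_conv eval_subst vX[symmetric] fun_upd_triv)
    qed
  qed
qed

lemma subst_step_solution_exists:
  assumes "subst_step E X E'" "solves v E"
  obtains w where "solves w E'" "\<And>A. A \<in> LV ` E \<Longrightarrow> w A = v A"
  using assms(1)
proof (rule subst_stepE)
  fix e0 x
  assume e0: "e0 \<in> E" "LV e0 = X" and x: "x \<notin> eqn_vars E"
    and E': "E' = insert (ref x e0) ((\<lambda>e. (LV e, subst (RE e) (RE (ref x e0)) X)) ` (E - {e0}))"
  \<comment> \<open>The value of X is the parameter for which \<open>ref\<close> reproduces the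
    given solution; freshness of \<open>x\<close> keeps the old equations true.\<close>
  define w where "w = v(x := v X)"
  have w: "w A = v A" if "A \<in> eqn_vars E" for A
    using that x by (auto simp: w_def)
  have wE: "w (LV e) = eval w (RE e)" if "e \<in> E" for e
  proof -
    have "eval w (RE e) = eval v (RE e)"
      using that by (intro eval_cong w) (auto simp: eqn_vars_def)
    moreover have "w (LV e) = v (LV e)"
      using that by (intro w) (simp add: eqn_vars_eq)
    ultimately show ?thesis using solvesD[OF assms(2) that] by simp
  qed
  have "w x = w (LV e0)" by (simp add: w_def e0(2))
  with eval_ref_fixpoint[OF wE[OF e0(1)]] have wX: "eval w (RE (ref x e0)) = w X"
    by (simp only: e0(2))
  have "solves w E'"
    unfolding solves_def E'
  proof (intro ballI, elim insertE imageE)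
    fix e assume "e = ref x e0"
    then show "w (LV e) = eval w (RE e)" using wX e0(2) by (simp only: LV_ref)
  next
    fix e e1 assume "e = (LV e1, subst (RE e1) (RE (ref x e0)) X)" "e1 \<in> E - {e0}"
    then show "w (LV e) = eval w (RE e)"
      using wE by (simp only: fst_conv snd_conv eval_subst wX fun_upd_triv Diff_iff)
  qed
  moreover have "w A = v A" if "A \<in> LV ` E" for A
    using that w by (simp add: eqn_vars_eq)
  ultimately show thesis using that by blast
qed

section \<open>Iterated substitution steps\<close>

lemma subst_steps_LV: "subst_steps E Xs E' \<Longrightarrow> LV ` E' = LV ` E"
  by (induction Xs arbitrary: E) (simp, metis subst_step_LV subst_steps.simps(2))

lemma subst_steps_var_eqn_set: "subst_steps E Xs E' \<Longrightarrow> var_eqn_set E \<Longrightarrow> var_eqn_set E'"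
  by (induction Xs arbitrary: E) (auto dest: subst_step_var_eqn_set)

text \<open>A step brings no left-hand variable back to the right, so eliminated variables stay
  eliminated.\<close>

lemma subst_steps_rhs_vars:
  "subst_steps E Xs E' \<Longrightarrow> rhs_vars E' \<inter> LV ` E \<subseteq> rhs_vars E - set Xs"
proof (induction Xs arbitrary: E)
  case (Cons X Xs)
  then obtain E1 where E1: "subst_step E X E1" "subst_steps E1 Xs E'" by auto
  from Cons.IH[OF E1(2)] subst_step_rhs_vars[OF E1(1)] subst_step_LV[OF E1(1)]
  show ?case by auto
qed auto

lemma solves_subst_stepsD: "subst_steps E Xs E' \<Longrightarrow> solves v E' \<Longrightarrow> solves v E"
  by (induction Xs arbitrary: E) (auto intro: solves_subst_stepD)

lemma subst_steps_solution_exists: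
  assumes "subst_steps E Xs E'" "solves v E"
  shows "\<exists>w. solves w E' \<and> (\<forall>A \<in> LV ` E. w A = v A)"
  using assms
proof (induction Xs arbitrary: E v)
  case Nil
  then show ?case by auto
next
  case (Cons X Xs)
  then obtain E1 where E1: "subst_step E X E1" "subst_steps E1 Xs E'" by auto
  obtain u where u: "solves u E1" "\<And>A. A \<in> LV ` E \<Longrightarrow> u A = v A"
    using subst_step_solution_exists[OF E1(1) Cons.prems(2)] by blast
  obtain w where "solves w E'" "\<forall>A \<in> LV ` E1. w A = u A"
    using Cons.IH[OF E1(2) u(1)] by blast
  with u(2) subst_step_LV[OF E1(1)] show ?case by auto
qed

section \<open>Completeness and generality of the resulting allocator\<close>

theorem theorem12:
  fixes AR :: "'v set" and ATT :: "('v \<times> 'v) set" and As :: "'v list"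
    and G :: "'v \<Rightarrow> 'v expr" and E :: "'v var_eqn set"
  assumes "argumentation_framework AR ATT"
    and "distinct As" and "AR = set As"
    and "\<And>A. A \<in> AR \<Longrightarrow> is_conj (\<lambda>A'. Neg (Var A')) (attackers ATT A) (G A)"
    and "subst_steps {(A, G A) | A. A \<in> AR} As E"
  shows "general_allocator AR ATT (\<lambda>A. RE (eqn_of E A))"
proof -
  let ?E0 = "{(A, G A) | A. A \<in> AR}" and ?R = "\<lambda>A. RE (eqn_of E A)"
  note G = assms(4) and steps = assms(5)
  have LV0: "LV ` ?E0 = AR" by force
  have "var_eqn_set ?E0" by (auto simp: var_eqn_set_def inj_on_def)
  then have E: "var_eqn_set E" and LV: "LV ` E = AR"
    using subst_steps_var_eqn_set[OF steps] subst_steps_LV[OF steps] LV0 by auto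
  have solves_E: "solves v E \<longleftrightarrow> (\<forall>A\<in>AR. v A = eval v (?R A))" for v
    unfolding solves_def LV[symmetric] ball_simps(9)
    by (rule ball_cong) (simp_all only: eqn_of_eq[OF E])
  have solves_E0: "solves v ?E0 \<longleftrightarrow> (\<forall>A\<in>AR. v A = eval v (G A))" for v
    by (auto simp: solves_def)
  \<comment> \<open>The list \<open>As\<close> runs through all arguments, so none survives on the
    right.\<close>
  have free: "vars (?R A) \<inter> AR = {}" if A: "A \<in> AR" for A
  proof -
    from A LV obtain e where "e \<in> E" "LV e = A" by auto
    with eqn_of_eq[OF E] have "eqn_of E A \<in> E" by metis
    then have "vars (?R A) \<subseteq> rhs_vars E" by (auto simp: rhs_vars_def)
    with subst_steps_rhs_vars[OF steps, unfolded LV0] show ?thesis using assms(3) by blast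
  qed
  have att: "attackers ATT A \<subseteq> AR" for A
    using assms(1) by (auto simp: argumentation_framework_def attackers_def)
  have complete: "complete_allocator AR ATT ?R"
    unfolding complete_allocator_def
  proof
    fix A assume A: "A \<in> AR"
    have "finite (attackers ATT A)"
      using att assms(3) by (metis List.finite_set finite_subset)
    then obtain c where c: "is_conj (\<lambda>A'. Neg (?R A')) (attackers ATT A) c"
      using is_conj_exists by blast
    have "eval v (?R A) = eval v c" for v
    proof -
      \<comment> \<open>Only arguments are revalued, and the right-hand sides \<open>?R B\<close>
        contain none; they keep their values, which makes \<open>w\<close> a solution.\<close>
      define w where "w B = (if B \<in> AR then eval v (?R B) else v B)" for B
      have w: "eval w (?R B) = eval v (?R B)" if "B \<in> AR" for B
        using free[OF that] by (intro eval_cong) (auto simp: w_def)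
      then have "solves w E" unfolding solves_E by (simp add: w_def)
      then have "solves w ?E0" by (rule solves_subst_stepsD[OF steps])
      then have "eval v (?R A) = eval w (G A)" using A by (simp add: solves_E0 w_def)
      also have "\<dots> = eval v c"
        using att by (intro eval_is_conj_cong[OF G[OF A] c]) (auto simp: w_def)
      finally show ?thesis .
    qed
    with c show "\<exists>c. is_conj (\<lambda>A'. Neg (?R A')) (attackers ATT A) c \<and> equivalent (?R A) c"
      by (auto simp: equivalent_def)
  qed
  have "\<exists>v. \<forall>A\<in>AR. E' A = Const (eval v (?R A))"
    if E': "constant_allocator AR ATT E'" for E' :: "'v \<Rightarrow> 'v expr"
  proof -
    \<comment> \<open>On \<open>AR\<close>, where \<open>E'\<close> is constant, any valuation reads
      off the constant; elsewhere this gives some default value.\<close>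
    define v where "v A = eval (\<lambda>_. U) (E' A)" for A
    have v: "E' A = Const (v A)" if "A \<in> AR" for A
      using E' that by (auto simp: constant_allocator_def v_def)
    \<comment> \<open>Completeness of \<open>E'\<close> says that its values solve the original
      equations.\<close>
    have "v A = eval v (G A)" if A: "A \<in> AR" for A
    proof -
      from E' A obtain c where c: "is_conj (\<lambda>A'. Neg (E' A')) (attackers ATT A) c"
        and eq: "equivalent (E' A) c"
        by (auto simp: constant_allocator_def complete_allocator_def)
      have "v A = eval v c" using eq v[OF A] by (simp add: equivalent_def)
      also have "\<dots> = eval v (G A)"
        using v[OF subsetD[OF att]] by (intro eval_is_conj_cong[OF c G[OF A]]) simp
      finally show ?thesis .
    qed
    then have "solves v ?E0" unfolding solves_E0 by (rule ballI)
    \<comment> \<open>Passing to \<open>w\<close> keeps the values of the arguments and supplies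
      suitable ones for the fresh variables.\<close>
    then obtain w where "solves w E" "\<forall>A\<in>AR. w A = v A"
      using subst_steps_solution_exists[OF steps, unfolded LV0] by blast
    then have "\<forall>A\<in>AR. E' A = Const (eval w (?R A))" using v unfolding solves_E by metis
    then show ?thesis by blast
  qed
  with complete show ?thesis by (simp add: general_allocator_def)
qed

end
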